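(* Let $m<n$ be positive integers, let $T$ be a real $(n\times m)$-matrix of full rank $m$, let $\mu>0$ be a constant, and let $F\in W_0(\mathbb{R}^n)$. Let $\alpha:\mathbb{R}^n\to\mathbb{R}$ be a measurable, bounded function for which $$\big|\,1-\alpha(\omega)\big(\mu+\|T^t\omega\|^2\big)\,\big|<1$$ holds for all $\omega\in\mathbb{R}^n$. Starting from $U_0=0$ or $U_1=\alpha F$, let $$U_{k+1}=(I-\alpha\mathcal{L})U_k+\alpha F,$$ where $\alpha$ also denotes the operator assigned to the function $\alpha$, and $\mathcal{L}$ is the operator with symbol $\mu+\|T^t\omega\|^2$ (both defined in the context). Then the iterates $U_k$ converge, in the norm $$\|V\|=\Big(\frac{1}{\sqrt{2\pi}}\Big)^n\int_{\mathbb{R}^n}|\widehat{V}(\omega)|\,d\omega,$$ to the solution $$U(y)=\Big(\frac{1}{\sqrt{2\pi}}\Big)^n\int_{\mathbb{R}^n}\frac{1}{\mu+\|T^t\omega\|^2}\,\widehat{F}(\omega)\,e^{i\omega\cdot y}\,d\omega$$ of the equation $\mathcal{L}U=F$.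
   Context: $W_0(\mathbb{R}^n)$ is the space of functions $V:\mathbb{R}^n\to\mathbb{R}$ that possess a (then unique) representation $$V(y)=\Big(\frac{1}{\sqrt{2\pi}}\Big)^n\int_{\mathbb{R}^n}\widehat{V}(\omega)\,e^{i\omega\cdot y}\,d\omega$$ in terms of a function $\widehat{V}\in L_1(\mathbb{R}^n)$, their Fourier transform. The operator $\alpha:W_0(\mathbb{R}^n)\to W_0(\mathbb{R}^n)$ assigned to the function $\alpha$ is given by $$(\alpha V)(y)=\Big(\frac{1}{\sqrt{2\pi}}\Big)^n\int_{\mathbb{R}^n}\alpha(\omega)\,\widehat{V}(\omega)\,e^{i\omega\cdot y}\,d\omega.$$ The operator $\mathcal{L}$ is given, for functions $V$ in its domain (those for which the following integrand is integrable), by $$(\mathcal{L}V)(y)=\Big(\frac{1}{\sqrt{2\pi}}\Big)^n\int_{\mathbb{R}^n}\big(\mu+\|T^t\omega\|^2\big)\,\widehat{V}(\omega)\,e^{i\omega\cdot y}\,d\omega.$$ Here $\|T^t\omega\|$ is the euclidian norm of $T^t\omega\in\mathbb{R}^m$, $T^t$ is the transpose of $T$, and $I$ is the identity. *)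

theory Defs
  imports "HOL-Analysis.Analysis"
begin

text \<open>Integration is with respect to Lebesgue measure, so that Lebesgue-measurable multipliers
  and \<open>L\<^sub>1\<close> functions are covered.\<close>

definition inverse_fourier :: "(real ^ 'n \<Rightarrow> complex) \<Rightarrow> real ^ 'n \<Rightarrow> complex" where
  "inverse_fourier g y =
     complex_of_real ((1 / sqrt (2 * pi)) ^ CARD('n)) *
     integral\<^sup>L lebesgue (\<lambda>\<omega>. g \<omega> * exp (\<i> * complex_of_real (\<omega> \<bullet> y)))"

definition fourier_represents :: "(real ^ 'n \<Rightarrow> complex) \<Rightarrow> (real ^ 'n \<Rightarrow> complex) \<Rightarrow> bool" where
  "fourier_represents g V \<longleftrightarrow> integrable lebesgue g \<and> V = inverse_fourier g"

text \<open>A multiplier that is not even maps real-valued functions to complex-valued ones. Functions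
  are therefore complex-valued throughout: \<open>W0_complex\<close> is the complex-valued version of the space
  \<open>W\<^sub>0\<close>, and \<open>W0\<close> is \<open>W\<^sub>0\<close> itself, its real-valued members.\<close>

definition W0_complex :: "(real ^ 'n \<Rightarrow> complex) set" where
  "W0_complex = {V. \<exists>g. fourier_represents g V}"

definition W0 :: "(real ^ 'n \<Rightarrow> complex) set" where
  "W0 = {V \<in> W0_complex. \<forall>y. V y \<in> \<real>}"

text \<open>The representing function is unique up to equality almost everywhere; the notions below do
  not depend on which representative is chosen. All of them are meaningful for arguments in
  \<open>W0_complex\<close> only.\<close>

definition fourier_transform :: "(real ^ 'n \<Rightarrow> complex) \<Rightarrow> real ^ 'n \<Rightarrow> complex" where
  "fourier_transform V = (SOME g. fourier_represents g V)"

definition W0_norm :: "(real ^ 'n \<Rightarrow> complex) \<Rightarrow> real" where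
  "W0_norm V = (1 / sqrt (2 * pi)) ^ CARD('n) *
     integral\<^sup>L lebesgue (\<lambda>\<omega>. cmod (fourier_transform V \<omega>))"

definition mult_op :: "(real ^ 'n \<Rightarrow> real) \<Rightarrow> (real ^ 'n \<Rightarrow> complex) \<Rightarrow> real ^ 'n \<Rightarrow> complex" where
  "mult_op a V = inverse_fourier (\<lambda>\<omega>. complex_of_real (a \<omega>) * fourier_transform V \<omega>)"

definition L_symbol :: "real ^ 'm ^ 'n \<Rightarrow> real \<Rightarrow> real ^ 'n \<Rightarrow> real" where
  "L_symbol T \<mu> \<omega> = \<mu> + (norm (transpose T *v \<omega>))\<^sup>2"

text \<open>\<open>L_op\<close> is total because the Bochner integral is; it is meaningful on \<open>L_domain\<close> only.\<close>

definition L_domain :: "real ^ 'm ^ 'n \<Rightarrow> real \<Rightarrow> (real ^ 'n \<Rightarrow> complex) set" where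
  "L_domain T \<mu> = {V \<in> W0_complex.
     integrable lebesgue (\<lambda>\<omega>. complex_of_real (L_symbol T \<mu> \<omega>) * fourier_transform V \<omega>)}"

definition L_op ::
  "real ^ 'm ^ 'n \<Rightarrow> real \<Rightarrow> (real ^ 'n \<Rightarrow> complex) \<Rightarrow> real ^ 'n \<Rightarrow> complex" where
  "L_op T \<mu> = mult_op (L_symbol T \<mu>)"

end

theory Submission
  imports Defs
begin

text \<open>On the Fourier side the iteration acts pointwise: with the symbol \<open>s \<omega> = \<mu> + \<parallel>T\<^sup>t \<omega>\<parallel>\<^sup>2\<close>, the
  transform of the error \<open>U\<^sub>k - U\<close> is multiplied in every step by \<open>1 - \<alpha> s\<close>, whose modulus is less
  than \<open>1\<close>. The errors therefore tend to zero pointwise, dominated by the initial error, and dominated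
  convergence gives convergence of their \<open>L\<^sub>1\<close> norms.

  That the transform of an iterate is well defined rests on the injectivity of the Fourier transform
  on \<open>L\<^sub>1\<close>. The functions \<open>G\<close> with vanishing transform are closed under multiplication by characters,
  hence by trigonometric polynomials, hence by \<open>\<omega> \<mapsto> f (cos (\<epsilon> (\<omega> \<bullet> e - c)))\<close> for continuous
  \<open>f\<close> (Weierstrass). Letting \<open>\<epsilon>\<close> tend to zero, with \<open>f\<close> depending on \<open>\<epsilon>\<close>, one reaches indicators
  of slabs, then of boxes and of Borel sets, so that \<open>G\<close> has vanishing integral over every Borel
  set.\<close>

subsection \<open>Injectivity of the Fourier transform on \<open>L\<^sub>1\<close>\<close>

text \<open>Integrability is demanded because the Bochner integral of a non-integrable function is 0
  by default. The normalising factor, being nonzero, is left out.\<close>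

definition vanishing_fourier :: "('a::euclidean_space \<Rightarrow> complex) \<Rightarrow> bool" where
  "vanishing_fourier G \<longleftrightarrow> integrable lebesgue G \<and>
     (\<forall>y. integral\<^sup>L lebesgue (\<lambda>\<omega>. G \<omega> * exp (\<i> * complex_of_real (\<omega> \<bullet> y))) = 0)"

lemma borel_measurable_lebesgueI:
  "f \<in> borel_measurable borel \<Longrightarrow> f \<in> borel_measurable lebesgue"
  by (simp add: measurable_completion)

lemma character_measurable [measurable]:
  "(\<lambda>\<omega>::'a::euclidean_space. exp (\<i> * complex_of_real (\<omega> \<bullet> y))) \<in> borel_measurable lebesgue"
  by (intro borel_measurable_lebesgueI borel_measurable_continuous_onI continuous_intros)

lemma integrable_bounded_mult:
  fixes f h :: "'a \<Rightarrow> complex"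
  assumes "integrable M f" "h \<in> borel_measurable M" "\<And>x. cmod (h x) \<le> B"
  shows "integrable M (\<lambda>x. h x * f x)"
proof (rule Bochner_Integration.integrable_bound)
  show "integrable M (\<lambda>x. B * cmod (f x))" using assms(1) by simp
  show "(\<lambda>x. h x * f x) \<in> borel_measurable M" using assms(1,2) by measurable
  show "AE x in M. cmod (h x * f x) \<le> norm (B * cmod (f x))"
  proof (intro always_eventually allI)
    fix x
    have "cmod (h x * f x) \<le> B * cmod (f x)"
      unfolding norm_mult by (intro mult_right_mono assms(3)) auto
    then show "cmod (h x * f x) \<le> norm (B * cmod (f x))" by simp
  qed
qed

lemma integrable_mult_character:
  assumes "integrable lebesgue G"
  shows "integrable lebesgue (\<lambda>\<omega>. G \<omega> * exp (\<i> * complex_of_real (\<omega> \<bullet> y)))"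
  using integrable_bounded_mult[OF assms character_measurable[of y], of 1] by (simp add: mult.commute)

section \<open>Stability under sums, characters and dominated limits\<close>

lemma vanishing_fourier_integrable: "vanishing_fourier G \<Longrightarrow> integrable lebesgue G"
  by (simp add: vanishing_fourier_def)

lemma vanishing_fourier_add:
  assumes "vanishing_fourier G" "vanishing_fourier H"
  shows "vanishing_fourier (\<lambda>\<omega>. G \<omega> + H \<omega>)"
  using assms unfolding vanishing_fourier_def
  by (auto simp: distrib_right integrable_mult_character)

lemma vanishing_fourier_cmult:
  assumes "vanishing_fourier G"
  shows "vanishing_fourier (\<lambda>\<omega>. c * G \<omega>)"
  using assms unfolding vanishing_fourier_def by (simp add: mult.assoc)

text \<open>Multiplication by a character translates the transform by \<open>z\<close>, and a
  translate of 0 is 0.\<close>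

lemma vanishing_fourier_character:
  assumes "vanishing_fourier G"
  shows "vanishing_fourier (\<lambda>\<omega>. exp (\<i> * complex_of_real (\<omega> \<bullet> z)) * G \<omega>)"
proof -
  have "exp (\<i> * complex_of_real (\<omega> \<bullet> z)) * G \<omega> * exp (\<i> * complex_of_real (\<omega> \<bullet> y))
      = G \<omega> * exp (\<i> * complex_of_real (\<omega> \<bullet> (z + y)))" for \<omega> y
    by (simp add: inner_add_right distrib_left exp_add)
  note eq = this
  have "integrable lebesgue (\<lambda>\<omega>. exp (\<i> * complex_of_real (\<omega> \<bullet> z)) * G \<omega>)"
    using assms by (intro integrable_bounded_mult[where B = 1]) (auto simp: vanishing_fourier_def)
  then show ?thesis
    using assms unfolding vanishing_fourier_def eq by simp
qed

text \<open>Euler's formula writes the cosine as two characters, at \<open>s *\<^sub>R e\<close> and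
  its negative; the shift \<open>c\<close> only contributes constant factors.\<close>

lemma vanishing_fourier_cos:
  assumes "vanishing_fourier G"
  shows "vanishing_fourier (\<lambda>\<omega>. complex_of_real (cos (s * (\<omega> \<bullet> e - c))) * G \<omega>)"
proof -
  have eq: "complex_of_real (cos (s * (\<omega> \<bullet> e - c)))
      = exp (- (\<i> * complex_of_real (s * c))) / 2 * exp (\<i> * complex_of_real (\<omega> \<bullet> (s *\<^sub>R e)))
      + exp (\<i> * complex_of_real (s * c)) / 2 * exp (\<i> * complex_of_real (\<omega> \<bullet> (- s *\<^sub>R e)))" for \<omega>
    by (simp add: cos_of_real[symmetric] cos_exp_eq mult_exp_exp algebra_simps add_divide_distrib)
  show ?thesis
    unfolding eq distrib_right mult.assoc
    by (intro vanishing_fourier_add vanishing_fourier_cmult vanishing_fourier_character assms)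
qed

text \<open>Dominated convergence at each \<open>y\<close>: characters have modulus 1, so the single
  majorant \<open>w\<close> serves for all of them.\<close>

lemma vanishing_fourier_limit:
  assumes G: "\<And>k. vanishing_fourier (G k)"
    and lim: "\<And>\<omega>. (\<lambda>k. G k \<omega>) \<longlonglongrightarrow> H \<omega>"
    and w: "integrable lebesgue w"
    and bound: "\<And>k \<omega>. cmod (G k \<omega>) \<le> w \<omega>"
  shows "vanishing_fourier H"
proof -
  have meas: "G k \<in> borel_measurable lebesgue" for k
    using vanishing_fourier_integrable[OF G] by auto
  have H: "H \<in> borel_measurable lebesgue"
    using lim meas by (rule borel_measurable_LIMSEQ_metric[rotated])
  have "integrable lebesgue H"
    by (rule integrable_dominated_convergence[where s = G, OF H meas w]) (use lim bound in auto)
  moreover have "(LINT \<omega>|lebesgue. H \<omega> * exp (\<i> * complex_of_real (\<omega> \<bullet> y))) = 0" for y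
  proof -
    have "(\<lambda>k. LINT \<omega>|lebesgue. G k \<omega> * exp (\<i> * complex_of_real (\<omega> \<bullet> y)))
        \<longlonglongrightarrow> (LINT \<omega>|lebesgue. H \<omega> * exp (\<i> * complex_of_real (\<omega> \<bullet> y)))"
    proof (rule integral_dominated_convergence[OF _ _ w])
      show "(\<lambda>\<omega>. H \<omega> * exp (\<i> * complex_of_real (\<omega> \<bullet> y))) \<in> borel_measurable lebesgue"
        using H by measurable
      show "(\<lambda>\<omega>. G k \<omega> * exp (\<i> * complex_of_real (\<omega> \<bullet> y))) \<in> borel_measurable lebesgue" for k
        using meas[of k] by measurable
    qed (use lim bound in \<open>auto simp: norm_mult intro!: tendsto_intros\<close>)
    moreover have "(LINT \<omega>|lebesgue. G k \<omega> * exp (\<i> * complex_of_real (\<omega> \<bullet> y))) = 0" for k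
      using G by (simp add: vanishing_fourier_def)
    ultimately show ?thesis by (simp add: LIMSEQ_const_iff)
  qed
  ultimately show ?thesis by (simp add: vanishing_fourier_def)
qed

section \<open>Localisation: from cosines to slabs, boxes and Borel sets\<close>

lemma vanishing_fourier_polynomial_cos:
  fixes p :: "real \<Rightarrow> real"
  assumes "real_polynomial_function p" "vanishing_fourier G"
  shows "vanishing_fourier (\<lambda>\<omega>. complex_of_real (p (cos (s * (\<omega> \<bullet> e - c)))) * G \<omega>)"
  using assms
proof (induction p arbitrary: G rule: real_polynomial_function.induct)
  case (linear f)
  then obtain a where "f = (\<lambda>x. x * a)" by (auto simp: real_bounded_linear)
  then have eq: "complex_of_real (f (cos (s * (\<omega> \<bullet> e - c)))) * G \<omega>
      = complex_of_real a * (complex_of_real (cos (s * (\<omega> \<bullet> e - c))) * G \<omega>)" for \<omega>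
    by (simp add: mult_ac)
  show ?case
    unfolding eq by (intro vanishing_fourier_cmult vanishing_fourier_cos linear.prems)
next
  case (const a)
  then show ?case by (rule vanishing_fourier_cmult)
next
  case (add f g)
  then show ?case by (simp add: distrib_right vanishing_fourier_add)
next
  \<comment> \<open>The induction is over all \<open>G\<close>: the hypothesis for \<open>f\<close>
    is applied to the product of \<open>g (cos ...)\<close> with \<open>G\<close>, which again has
    vanishing transform.\<close>
  case (mult f g)
  then show ?case by (simp add: mult.assoc)
qed

text \<open>Polynomials approximate \<open>f\<close> uniformly on \<open>{-1..1}\<close>, where the
  cosine takes its values. An error of at most 1 keeps them below \<open>B + 1\<close>, so a
  multiple of \<open>cmod (G \<omega>)\<close> dominates.\<close>

lemma vanishing_fourier_continuous_cos:
  fixes f :: "real \<Rightarrow> real"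
  assumes f: "continuous_on {-1..1} f" and G: "vanishing_fourier G"
  shows "vanishing_fourier (\<lambda>\<omega>. complex_of_real (f (cos (s * (\<omega> \<bullet> e - c)))) * G \<omega>)"
proof -
  have "\<exists>p. real_polynomial_function p \<and> (\<forall>x\<in>{-1..1}. \<bar>f x - p x\<bar> < 1 / real (Suc k))" for k
    using Stone_Weierstrass_real_polynomial_function[OF compact_Icc f, of "1 / real (Suc k)"]
    by (metis of_nat_0_less_iff zero_less_Suc zero_less_divide_1_iff)
  then obtain p where p: "\<And>k. real_polynomial_function (p k)"
    and approx: "\<And>k x. x \<in> {-1..1} \<Longrightarrow> \<bar>f x - p k x\<bar> < 1 / real (Suc k)" by metis
  obtain B where B: "\<And>x. x \<in> {-1..1} \<Longrightarrow> \<bar>f x\<bar> \<le> B"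
    using compact_imp_bounded[OF compact_continuous_image[OF f compact_Icc]]
    unfolding bounded_iff by (metis imageI real_norm_def)
  have lim: "(\<lambda>k. p k x) \<longlonglongrightarrow> f x" if "x \<in> {-1..1}" for x
  proof (rule LIM_zero_cancel, rule Lim_null_comparison)
    show "\<forall>\<^sub>F k in sequentially. norm (p k x - f x) \<le> 1 / real (Suc k)"
      using approx[OF that] by (auto intro!: always_eventually simp: abs_minus_commute less_imp_le)
    show "(\<lambda>k. 1 / real (Suc k)) \<longlonglongrightarrow> 0" by (rule LIMSEQ_Suc[OF lim_1_over_n])
  qed
  have bound: "\<bar>p k x\<bar> \<le> B + 1" if "x \<in> {-1..1}" for k x
  proof -
    have "1 / real (Suc k) \<le> 1" by simp
    with approx[OF that, of k] B[OF that] show ?thesis by linarith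
  qed
  show ?thesis
  proof (rule vanishing_fourier_limit)
    show "vanishing_fourier (\<lambda>\<omega>. complex_of_real (p k (cos (s * (\<omega> \<bullet> e - c)))) * G \<omega>)" for k
      by (rule vanishing_fourier_polynomial_cos[OF p G])
    show "(\<lambda>k. complex_of_real (p k (cos (s * (\<omega> \<bullet> e - c)))) * G \<omega>)
        \<longlonglongrightarrow> complex_of_real (f (cos (s * (\<omega> \<bullet> e - c)))) * G \<omega>" for \<omega>
      by (intro tendsto_intros lim) auto
    show "integrable lebesgue (\<lambda>\<omega>. (B + 1) * cmod (G \<omega>))"
      using vanishing_fourier_integrable[OF G] by simp
    show "cmod (complex_of_real (p k (cos (s * (\<omega> \<bullet> e - c)))) * G \<omega>) \<le> (B + 1) * cmod (G \<omega>)" for k \<omega>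
      by (auto simp: norm_mult intro!: mult_right_mono bound)
  qed
qed

text \<open>The slab is the set where \<open>\<bar>t\<bar> < r\<close> for \<open>t = \<omega> \<bullet> e - c\<close>. Its indicator is the limit of the
  clamped functions \<open>h N \<bar>t\<bar>\<close>, and \<open>h N \<bar>t\<bar>\<close> is a continuous function of \<open>cos (t / N)\<close> as long
  as \<open>\<bar>t\<bar> \<le> \<pi> N\<close>.\<close>
lemma vanishing_fourier_slab:
  assumes G: "vanishing_fourier G"
  shows "vanishing_fourier (\<lambda>\<omega>. indicator {\<omega>. \<bar>\<omega> \<bullet> e - c\<bar> < r} \<omega> * G \<omega>)"
proof -
  define h :: "nat \<Rightarrow> real \<Rightarrow> real" where "h N u = min 1 (max 0 (real N * (r - u)))" for N u
  define f where "f N x = h N (real N * arccos x)" for N x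
  have h_bound: "\<bar>h N u\<bar> \<le> 1" for N u by (auto simp: h_def)
  \<comment> \<open>The ramp descends from 1 to 0 over a width of \<open>1 / N\<close> just inside
    \<open>r\<close>, and is already 0 at \<open>u = r\<close>. The limit is therefore the indicator
    of the open slab at every point, the boundary included.\<close>
  have h_lim: "(\<lambda>N. h N u) \<longlonglongrightarrow> (if u < r then 1 else 0)" for u
  proof (cases "u < r")
    case True
    have "\<forall>\<^sub>F N in sequentially. h N u = 1"
      using eventually_ge_at_top[of "nat \<lceil>1 / (r - u)\<rceil>"]
    proof eventually_elim
      case (elim N)
      then have "1 / (r - u) \<le> real N" by linarith
      then have "1 \<le> real N * (r - u)" using True by (simp add: divide_simps)
      then show ?case by (simp add: h_def)
    qed
    then show ?thesis using True by (simp add: tendsto_eventually)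
  next
    case False
    then have "h N u = 0" for N by (auto simp: h_def mult_nonneg_nonpos)
    then show ?thesis using False by simp
  qed
  \<comment> \<open>Each fixed \<open>t\<close> eventually lies in the range where
    \<open>arccos\<close> inverts the cosine. Beyond that range the function repeats periodically,
    which is harmless since it stays bounded by 1. The \<open>Suc\<close> below keeps the divisor
    \<open>N\<close> positive when \<open>t = 0\<close>.\<close>
  have f_cos: "\<forall>\<^sub>F N in sequentially. f N (cos (1 / real N * t)) = h N \<bar>t\<bar>" for t
    using eventually_ge_at_top[of "Suc (nat \<lceil>\<bar>t\<bar>\<rceil>)"]
  proof eventually_elim
    case (elim N)
    then have N: "\<bar>t\<bar> \<le> real N" "0 < N" by linarith+
    then have "\<bar>t\<bar> / real N \<le> 1" by simp
    then have "\<bar>t\<bar> / real N \<le> pi" using pi_gt3 by linarith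
    then have "arccos (cos (\<bar>t\<bar> / real N)) = \<bar>t\<bar> / real N"
      by (intro arccos_cos) auto
    moreover have "cos (1 / real N * t) = cos (\<bar>t\<bar> / real N)"
      by (cases "t \<ge> 0") auto
    ultimately show ?case using N by (simp add: f_def)
  qed
  show ?thesis
  proof (rule vanishing_fourier_limit)
    show "vanishing_fourier (\<lambda>\<omega>. complex_of_real (f N (cos (1 / real N * (\<omega> \<bullet> e - c)))) * G \<omega>)" for N
    proof (rule vanishing_fourier_continuous_cos[OF _ G])
      show "continuous_on {-1..1} (f N)"
        unfolding f_def h_def by (intro continuous_intros) auto
    qed
    fix \<omega>
    have "(\<lambda>N. f N (cos (1 / real N * (\<omega> \<bullet> e - c)))) \<longlonglongrightarrow> (if \<bar>\<omega> \<bullet> e - c\<bar> < r then 1 else 0)"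
      by (rule Lim_transform_eventually[OF h_lim])
        (rule eventually_mono[OF f_cos[of "\<omega> \<bullet> e - c"]], simp)
    then have "(\<lambda>N. complex_of_real (f N (cos (1 / real N * (\<omega> \<bullet> e - c)))) * G \<omega>)
        \<longlonglongrightarrow> complex_of_real (if \<bar>\<omega> \<bullet> e - c\<bar> < r then 1 else 0) * G \<omega>"
      by (intro tendsto_intros)
    then show "(\<lambda>N. complex_of_real (f N (cos (1 / real N * (\<omega> \<bullet> e - c)))) * G \<omega>)
        \<longlonglongrightarrow> indicator {\<omega>. \<bar>\<omega> \<bullet> e - c\<bar> < r} \<omega> * G \<omega>"
      by (auto simp: indicator_def split: if_splits)
    show "cmod (complex_of_real (f N (cos (1 / real N * (\<omega> \<bullet> e - c)))) * G \<omega>) \<le> cmod (G \<omega>)" for N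
      unfolding norm_mult norm_of_real f_def by (intro mult_left_le_one_le h_bound) auto
  qed (use vanishing_fourier_integrable[OF G] in simp)
qed

text \<open>A box is the intersection of slabs over the coordinate directions, each given by
  midpoint and half-width. The slabs are cut out one after the other, the already restricted
  function taking the place of \<open>G\<close>.\<close>

lemma vanishing_fourier_box:
  assumes G: "vanishing_fourier G"
  shows "vanishing_fourier (\<lambda>\<omega>. indicator (box a b) \<omega> * G \<omega>)"
proof -
  have "vanishing_fourier (\<lambda>\<omega>. indicator {\<omega>. \<forall>i\<in>S. a \<bullet> i < \<omega> \<bullet> i \<and> \<omega> \<bullet> i < b \<bullet> i} \<omega> * G \<omega>)"
    if "finite S" for S
    using that
  proof (induction S)
    case empty
    then show ?case using G by simp
  next
    case (insert j S)
    have eq: "indicator {\<omega>. \<forall>i\<in>insert j S. a \<bullet> i < \<omega> \<bullet> i \<and> \<omega> \<bullet> i < b \<bullet> i} \<omega> * G \<omega> =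
       indicator {\<omega>. \<bar>\<omega> \<bullet> j - (a \<bullet> j + b \<bullet> j) / 2\<bar> < (b \<bullet> j - a \<bullet> j) / 2} \<omega> *
       (indicator {\<omega>. \<forall>i\<in>S. a \<bullet> i < \<omega> \<bullet> i \<and> \<omega> \<bullet> i < b \<bullet> i} \<omega> * G \<omega>)" for \<omega>
    proof -
      have "\<bar>\<omega> \<bullet> j - (a \<bullet> j + b \<bullet> j) / 2\<bar> < (b \<bullet> j - a \<bullet> j) / 2 \<longleftrightarrow> a \<bullet> j < \<omega> \<bullet> j \<and> \<omega> \<bullet> j < b \<bullet> j"
        by (simp add: abs_less_iff field_simps) linarith
      then show ?thesis by (auto simp: indicator_def)
    qed
    show ?case unfolding eq by (rule vanishing_fourier_slab[OF insert.IH])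
  qed
  from this[OF finite_Basis] show ?thesis by (simp add: box_def)
qed

text \<open>Dynkin's pi-lambda argument: boxes are closed under intersection and generate the Borel
  sets. Complements are handled by linearity, disjoint unions by dominated convergence of the finite
  partial unions.\<close>

lemma vanishing_fourier_borel:
  fixes G :: "'a::euclidean_space \<Rightarrow> complex"
  assumes G: "vanishing_fourier G" and A: "A \<in> sets borel"
  shows "vanishing_fourier (\<lambda>\<omega>. indicator A \<omega> * G \<omega>)"
proof -
  have "Int_stable (range (\<lambda>(a, b). box a b :: 'a set))"
    by (auto simp: Int_stable_def box_Int_box)
  moreover have "range (\<lambda>(a, b). box a b :: 'a set) \<subseteq> Pow UNIV" by simp
  moreover have "A \<in> sigma_sets UNIV (range (\<lambda>(a, b). box a b :: 'a set))"
    using A unfolding borel_eq_box by simp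
  ultimately show ?thesis
  proof (induction rule: sigma_sets_induct_disjoint[consumes 3, case_names basic empty compl union])
    case (basic A)
    then show ?case using vanishing_fourier_box[OF G] by auto
  next
    case empty
    then show ?case by (simp add: vanishing_fourier_def)
  next
    case (compl A)
    have eq: "indicator (UNIV - A) \<omega> * G \<omega> = G \<omega> + (- 1) * (indicator A \<omega> * G \<omega>)" for \<omega>
      by (auto simp: indicator_def)
    show ?case unfolding eq by (intro vanishing_fourier_add vanishing_fourier_cmult G compl.IH)
  next
    case (union A)
    show ?case
    proof (rule vanishing_fourier_limit)
      show "vanishing_fourier (\<lambda>\<omega>. indicator (\<Union>i<k. A i) \<omega> * G \<omega>)" for k :: nat
      proof (induction k)
        case 0
        then show ?case by (simp add: vanishing_fourier_def)
      next
        case (Suc k)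
        have "indicator (\<Union>i<Suc k. A i) \<omega> * G \<omega>
            = indicator (A k) \<omega> * G \<omega> + indicator (\<Union>i<k. A i) \<omega> * G \<omega>" for \<omega>
        proof (cases "\<omega> \<in> A k")
          case True
          have "\<omega> \<notin> A i" if "i < k" for i
            using disjoint_family_onD[OF union.hyps(1), of i k] True that by auto
          then have "\<omega> \<notin> (\<Union>i<k. A i)" by blast
          with True show ?thesis by (simp add: indicator_def lessThan_Suc)
        qed (auto simp: indicator_def less_Suc_eq)
        then show ?case using vanishing_fourier_add[OF union.IH Suc.IH] by simp
      qed
      show "(\<lambda>k. indicator (\<Union>i<k. A i) \<omega> * G \<omega>) \<longlonglongrightarrow> indicator (\<Union>i. A i) \<omega> * G \<omega>" for \<omega>
        by (intro tendsto_intros LIMSEQ_indicator_UN)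
      show "integrable lebesgue (\<lambda>\<omega>. cmod (G \<omega>))"
        using vanishing_fourier_integrable[OF G] by simp
      show "cmod (indicator (\<Union>i<k. A i) \<omega> * G \<omega>) \<le> cmod (G \<omega>)" for k :: nat and \<omega>
        by (auto simp: indicator_def)
    qed
  qed
qed

text \<open>Balls of integer radius exhaust the space; this supplies the sigma-finiteness that
  \<open>density_zero\<close> asks for.\<close>

lemma sigma_finite_lebesgue: "sigma_finite_measure (lebesgue :: 'a::euclidean_space measure)"
proof
  show "\<exists>A. countable A \<and> A \<subseteq> sets (lebesgue :: 'a measure) \<and> \<Union> A = space lebesgue
      \<and> (\<forall>a\<in>A. emeasure lebesgue a \<noteq> \<infinity>)"
  proof (intro exI[of _ "range (\<lambda>n::nat. cball (0::'a) (real n))"] conjI)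
    show "\<Union> (range (\<lambda>n::nat. cball (0::'a) (real n))) = space lebesgue"
      using real_arch_simple by auto
    show "\<forall>a\<in>range (\<lambda>n::nat. cball (0::'a) (real n)). emeasure lebesgue a \<noteq> \<infinity>"
      using emeasure_lborel_cball_finite by (auto simp: less_top)
  qed auto
qed

text \<open>An integrable function whose integrals over all measurable sets vanish is 0 almost
  everywhere. A Lebesgue set is a Borel set up to a null set, so the Borel case suffices.\<close>

theorem vanishing_fourier_AE_zero:
  fixes G :: "'a::euclidean_space \<Rightarrow> complex"
  assumes G: "vanishing_fourier G"
  shows "AE \<omega> in lebesgue. G \<omega> = 0"
proof (rule sigma_finite_measure.density_zero[OF sigma_finite_lebesgue vanishing_fourier_integrable[OF G]])
  fix A :: "'a set"
  assume A: "A \<in> sets lebesgue"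
  then obtain B N where B: "B \<in> sets borel" "negligible N" "B \<union> N = A"
    by (rule sets_lebesgue_almost_borel)
  have "AE \<omega> in lebesgue. \<omega> \<notin> N"
    using B(2) by (simp add: negligible_iff_null_sets AE_not_in)
  have "set_lebesgue_integral lebesgue A G = (LINT \<omega>|lebesgue. indicator B \<omega> * G \<omega>)"
    unfolding set_lebesgue_integral_def
  proof (rule integral_cong_AE)
    show "AE \<omega> in lebesgue. indicat_real A \<omega> *\<^sub>R G \<omega> = indicator B \<omega> * G \<omega>"
      using \<open>AE \<omega> in lebesgue. \<omega> \<notin> N\<close> by eventually_elim (use B(3) in \<open>auto simp: indicator_def\<close>)
    have "G \<in> borel_measurable lebesgue" using vanishing_fourier_integrable[OF G] by simp
    then show "(\<lambda>\<omega>. indicat_real A \<omega> *\<^sub>R G \<omega>) \<in> borel_measurable lebesgue" using A by simp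
    show "(\<lambda>\<omega>. indicator B \<omega> * G \<omega>) \<in> borel_measurable lebesgue"
      using vanishing_fourier_integrable[OF vanishing_fourier_borel[OF G B(1)]] by simp
  qed
  \<comment> \<open>The integral is the transform of the restricted function at frequency
    \<open>y = 0\<close>.\<close>
  also have "\<dots> = 0"
    using vanishing_fourier_borel[OF G B(1)] unfolding vanishing_fourier_def
    by (auto dest: spec[of _ 0])
  finally show "set_lebesgue_integral lebesgue A G = 0" .
qed

subsection \<open>Fourier representations and multipliers\<close>

lemma inverse_fourier_cong_AE:
  assumes "g \<in> borel_measurable lebesgue" "h \<in> borel_measurable lebesgue"
    and "AE \<omega> in lebesgue. g \<omega> = h \<omega>"
  shows "inverse_fourier g = inverse_fourier h"
proof
  fix y
  have "(LINT \<omega>|lebesgue. g \<omega> * exp (\<i> * complex_of_real (\<omega> \<bullet> y)))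
      = (LINT \<omega>|lebesgue. h \<omega> * exp (\<i> * complex_of_real (\<omega> \<bullet> y)))"
  proof (rule integral_cong_AE)
    show "AE \<omega> in lebesgue. g \<omega> * exp (\<i> * complex_of_real (\<omega> \<bullet> y))
        = h \<omega> * exp (\<i> * complex_of_real (\<omega> \<bullet> y))"
      using assms(3) by eventually_elim simp
  qed (use assms(1,2) in measurable)
  then show "inverse_fourier g y = inverse_fourier h y" by (simp add: inverse_fourier_def)
qed

lemma fourier_represents_add:
  assumes "fourier_represents g V" "fourier_represents h W"
  shows "fourier_represents (\<lambda>\<omega>. g \<omega> + h \<omega>) (\<lambda>y. V y + W y)"
  using assms unfolding fourier_represents_def
  by (auto simp: inverse_fourier_def distrib_right distrib_left integrable_mult_character)

lemma fourier_represents_diff: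
  assumes "fourier_represents g V" "fourier_represents h W"
  shows "fourier_represents (\<lambda>\<omega>. g \<omega> - h \<omega>) (\<lambda>y. V y - W y)"
  using assms unfolding fourier_represents_def
  by (auto simp: inverse_fourier_def left_diff_distrib right_diff_distrib integrable_mult_character)

text \<open>The difference of two representing functions represents 0; the normalising constant is
  nonzero, so injectivity applies.\<close>

lemma fourier_represents_unique:
  assumes g: "fourier_represents g V" and h: "fourier_represents h V"
  shows "AE \<omega> in lebesgue. g \<omega> = h \<omega>"
proof -
  have "fourier_represents (\<lambda>\<omega>. g \<omega> - h \<omega>) (\<lambda>y. 0)"
    using fourier_represents_diff[OF g h] by simp
  then have "vanishing_fourier (\<lambda>\<omega>. g \<omega> - h \<omega>)"
    unfolding fourier_represents_def vanishing_fourier_def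
    by (auto simp: inverse_fourier_def fun_eq_iff)
  from vanishing_fourier_AE_zero[OF this] show ?thesis by simp
qed

lemma fourier_represents_measurable:
  "fourier_represents g V \<Longrightarrow> g \<in> borel_measurable lebesgue"
  by (auto simp: fourier_represents_def)

lemma fourier_represents_AE_cong:
  assumes g: "fourier_represents g V" and h: "h \<in> borel_measurable lebesgue"
    and eq: "AE \<omega> in lebesgue. g \<omega> = h \<omega>"
  shows "fourier_represents h V"
proof -
  have "g \<in> borel_measurable lebesgue" using g by (rule fourier_represents_measurable)
  then show ?thesis
    using g h eq integrable_cong_AE[of g lebesgue h] inverse_fourier_cong_AE[of g h]
    by (simp add: fourier_represents_def)
qed

lemma fourier_represents_fourier_transform:
  "fourier_represents g V \<Longrightarrow> fourier_represents (fourier_transform V) V"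
  unfolding fourier_transform_def by (rule someI[of "\<lambda>g. fourier_represents g V"])

text \<open>Pins down the choice made in \<open>fourier_transform\<close> up to a null set, so that
  computations may use any convenient representative.\<close>

lemma fourier_transform_AE:
  "fourier_represents g V \<Longrightarrow> AE \<omega> in lebesgue. fourier_transform V \<omega> = g \<omega>"
  by (rule fourier_represents_unique[OF fourier_represents_fourier_transform])

lemma W0_complexI: "fourier_represents g V \<Longrightarrow> V \<in> W0_complex"
  by (auto simp: W0_complex_def)

lemma W0_complexD: "V \<in> W0_complex \<Longrightarrow> fourier_represents (fourier_transform V) V"
  by (auto simp: W0_complex_def dest: fourier_represents_fourier_transform)

text \<open>The three facts are bundled because together they are the premises of the
  almost-everywhere congruence rules for integrability and for
  \<open>inverse_fourier\<close>.\<close>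

lemma multiplier_fourier_transform_AE:
  assumes g: "fourier_represents g V" and a: "a \<in> borel_measurable lebesgue"
  shows "AE \<omega> in lebesgue. complex_of_real (a \<omega>) * fourier_transform V \<omega> = complex_of_real (a \<omega>) * g \<omega>"
    and "(\<lambda>\<omega>. complex_of_real (a \<omega>) * fourier_transform V \<omega>) \<in> borel_measurable lebesgue"
    and "(\<lambda>\<omega>. complex_of_real (a \<omega>) * g \<omega>) \<in> borel_measurable lebesgue"
proof -
  show "AE \<omega> in lebesgue. complex_of_real (a \<omega>) * fourier_transform V \<omega> = complex_of_real (a \<omega>) * g \<omega>"
    using fourier_transform_AE[OF g] by eventually_elim simp
  have [measurable]: "g \<in> borel_measurable lebesgue" "fourier_transform V \<in> borel_measurable lebesgue"
    using g fourier_represents_fourier_transform[OF g] by (auto intro: fourier_represents_measurable)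
  note a [measurable]
  show "(\<lambda>\<omega>. complex_of_real (a \<omega>) * fourier_transform V \<omega>) \<in> borel_measurable lebesgue"
    and "(\<lambda>\<omega>. complex_of_real (a \<omega>) * g \<omega>) \<in> borel_measurable lebesgue"
    by measurable
qed

lemma integrable_multiplier_iff:
  assumes "fourier_represents g V" "a \<in> borel_measurable lebesgue"
  shows "integrable lebesgue (\<lambda>\<omega>. complex_of_real (a \<omega>) * fourier_transform V \<omega>)
    \<longleftrightarrow> integrable lebesgue (\<lambda>\<omega>. complex_of_real (a \<omega>) * g \<omega>)"
  using multiplier_fourier_transform_AE[OF assms] by (intro integrable_cong_AE)

text \<open>Asking for integrability of the product lets one rule cover both the bounded multiplier
  and the symbol of the operator \<open>L_op\<close>, which may be unbounded.\<close>

lemma fourier_represents_mult_op: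
  assumes g: "fourier_represents g V" and a: "a \<in> borel_measurable lebesgue"
    and int: "integrable lebesgue (\<lambda>\<omega>. complex_of_real (a \<omega>) * g \<omega>)"
  shows "fourier_represents (\<lambda>\<omega>. complex_of_real (a \<omega>) * g \<omega>) (mult_op a V)"
  using inverse_fourier_cong_AE[OF multiplier_fourier_transform_AE(2,3,1)[OF g a]] int
  by (simp add: fourier_represents_def mult_op_def)

lemma W0_norm_represents:
  fixes g :: "real ^ 'n \<Rightarrow> complex"
  assumes g: "fourier_represents g V"
  shows "W0_norm V = (1 / sqrt (2 * pi)) ^ CARD('n) * (LINT \<omega>|lebesgue. cmod (g \<omega>))"
proof -
  have [measurable]: "g \<in> borel_measurable lebesgue" "fourier_transform V \<in> borel_measurable lebesgue"
    using g fourier_represents_fourier_transform[OF g] by (auto intro: fourier_represents_measurable)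
  have "(LINT \<omega>|lebesgue. cmod (fourier_transform V \<omega>)) = (LINT \<omega>|lebesgue. cmod (g \<omega>))"
  proof (rule integral_cong_AE)
    show "AE \<omega> in lebesgue. cmod (fourier_transform V \<omega>) = cmod (g \<omega>)"
      using fourier_transform_AE[OF g] by eventually_elim simp
  qed measurable
  then show ?thesis by (simp add: W0_norm_def)
qed

section \<open>Reflection, conjugation and real-valuedness\<close>

lemma lebesgue_uminus:
  shows "(uminus :: 'a::euclidean_space \<Rightarrow> 'a) \<in> lebesgue \<rightarrow>\<^sub>M lebesgue"
    and "distr lebesgue lebesgue uminus = (lebesgue :: 'a measure)"
proof -
  \<comment> \<open>Reflection is the affine map with all coefficients -1, whose Jacobian factor has
    absolute value 1.\<close>
  have eq: "(\<lambda>x. 0 + (\<Sum>j\<in>Basis. (- 1 * (x \<bullet> j)) *\<^sub>R j)) = (uminus :: 'a \<Rightarrow> 'a)"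
    by (simp add: fun_eq_iff sum_negf euclidean_representation)
  show "(uminus :: 'a \<Rightarrow> 'a) \<in> lebesgue \<rightarrow>\<^sub>M lebesgue"
    using lebesgue_affine_measurable[of "\<lambda>_. - 1" "0 :: 'a"] unfolding eq by simp
  show "distr lebesgue lebesgue uminus = (lebesgue :: 'a measure)"
    using lebesgue_affine_euclidean[of "\<lambda>_. - 1" "0 :: 'a"] unfolding eq by (simp add: density_1)
qed

text \<open>Conjugation inverts the character, and the substitution of \<open>- \<omega>\<close> for
  \<open>\<omega>\<close> restores it. By uniqueness, a real-valued function has a Hermitian
  transform almost everywhere.\<close>

lemma fourier_represents_cnj:
  assumes g: "fourier_represents g V"
  shows "fourier_represents (\<lambda>\<omega>. cnj (g (- \<omega>))) (\<lambda>y. cnj (V y))"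
proof -
  have int: "integrable lebesgue g" and V: "V = inverse_fourier g"
    using g by (simp_all add: fourier_represents_def)
  have "integrable (distr lebesgue lebesgue uminus) g"
    using int by (simp add: lebesgue_uminus)
  then have "integrable lebesgue (\<lambda>\<omega>. g (- \<omega>))"
    by (rule integrable_distr[OF lebesgue_uminus(1)])
  moreover have "cnj (inverse_fourier g y) = inverse_fourier (\<lambda>\<omega>. cnj (g (- \<omega>))) y" for y
  proof -
    let ?f = "\<lambda>\<omega>. g \<omega> * exp (\<i> * complex_of_real (\<omega> \<bullet> y))"
    have "?f \<in> borel_measurable lebesgue" using int by measurable
    then have "integral\<^sup>L lebesgue ?f = (LINT \<omega>|lebesgue. ?f (- \<omega>))"
      using integral_distr[OF lebesgue_uminus(1), of ?f] by (simp add: lebesgue_uminus)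
    then have "cnj (integral\<^sup>L lebesgue ?f) = (LINT \<omega>|lebesgue. cnj (?f (- \<omega>)))"
      by (simp only: Bochner_Integration.integral_cnj)
    also have "\<dots> = (LINT \<omega>|lebesgue. cnj (g (- \<omega>)) * exp (\<i> * complex_of_real (\<omega> \<bullet> y)))"
      by (simp add: exp_cnj)
    finally show ?thesis by (simp add: inverse_fourier_def)
  qed
  ultimately show ?thesis by (simp add: fourier_represents_def V)
qed

lemma W0D:
  assumes "V \<in> W0"
  shows "fourier_represents (fourier_transform V) V" and "(\<lambda>y. cnj (V y)) = V"
  using assms by (auto simp: W0_def W0_complexD Reals_cnj_iff)

lemma W0_add: "V \<in> W0 \<Longrightarrow> W \<in> W0 \<Longrightarrow> (\<lambda>y. V y + W y) \<in> W0"
  by (auto simp: W0_def W0_complex_def intro: fourier_represents_add)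

lemma W0_diff: "V \<in> W0 \<Longrightarrow> W \<in> W0 \<Longrightarrow> (\<lambda>y. V y - W y) \<in> W0"
  by (auto simp: W0_def W0_complex_def intro: fourier_represents_diff)

lemma fourier_represents_zero: "fourier_represents (\<lambda>\<omega>. 0) (\<lambda>y. 0)"
  by (simp add: fourier_represents_def inverse_fourier_def fun_eq_iff)

text \<open>A real even multiplier preserves the Hermitian symmetry of the transform, hence
  real-valuedness.\<close>

lemma mult_op_even_W0:
  assumes V: "V \<in> W0" and a: "a \<in> borel_measurable lebesgue" and even: "\<And>\<omega>. a (- \<omega>) = a \<omega>"
    and int: "integrable lebesgue (\<lambda>\<omega>. complex_of_real (a \<omega>) * fourier_transform V \<omega>)"
  shows "mult_op a V \<in> W0"
proof -
  let ?g = "fourier_transform V"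
  have g: "fourier_represents ?g V" by (rule W0D(1)[OF V])
  have "AE \<omega> in lebesgue. cnj (?g (- \<omega>)) = ?g \<omega>"
    using fourier_represents_cnj[OF g] g unfolding W0D(2)[OF V] by (rule fourier_represents_unique)
  then have AE: "AE \<omega> in lebesgue. cnj (complex_of_real (a (- \<omega>)) * ?g (- \<omega>)) = complex_of_real (a \<omega>) * ?g \<omega>"
    by eventually_elim (simp add: even)
  have rep: "fourier_represents (\<lambda>\<omega>. complex_of_real (a \<omega>) * ?g \<omega>) (mult_op a V)"
    by (rule fourier_represents_mult_op[OF g a int])
  have "fourier_represents (\<lambda>\<omega>. complex_of_real (a \<omega>) * ?g \<omega>) (\<lambda>y. cnj (mult_op a V y))"
    by (rule fourier_represents_AE_cong[OF fourier_represents_cnj[OF rep] _ AE])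
      (rule borel_measurable_integrable[OF int])
  then have "cnj (mult_op a V y) = mult_op a V y" for y
    using rep by (simp add: fourier_represents_def fun_eq_iff)
  then show ?thesis
    using rep by (auto simp: W0_def Reals_cnj_iff intro: W0_complexI)
qed

subsection \<open>The iteration\<close>

lemma L_symbol_measurable [measurable]: "L_symbol T \<mu> \<in> borel_measurable lebesgue"
  unfolding L_symbol_def
  by (intro borel_measurable_lebesgueI borel_measurable_continuous_onI continuous_intros
      linear_continuous_on_compose[OF continuous_on_id] matrix_vector_mul_linear)

lemma L_symbol_even: "L_symbol T \<mu> (- \<omega>) = L_symbol T \<mu> \<omega>"
  using linear_neg[OF matrix_vector_mul_linear, of "transpose T" \<omega>] by (simp add: L_symbol_def)

lemma L_symbol_ge: "\<mu> \<le> L_symbol T \<mu> \<omega>"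
  by (simp add: L_symbol_def)

lemma L_domain_iff:
  assumes "fourier_represents g V"
  shows "V \<in> L_domain T \<mu> \<longleftrightarrow> integrable lebesgue (\<lambda>\<omega>. complex_of_real (L_symbol T \<mu> \<omega>) * g \<omega>)"
  using integrable_multiplier_iff[OF assms L_symbol_measurable] W0_complexI[OF assms]
  by (simp add: L_domain_def)

text \<open>Here \<open>u\<close> is the transform of the solution and \<open>d\<close> that of the error.\<close>
lemma fourier_represents_step:
  fixes T :: "real ^ 'm ^ 'n" and \<mu> :: real and u f d :: "real ^ 'n \<Rightarrow> complex"
  defines "s \<equiv> L_symbol T \<mu>"
  assumes F: "fourier_represents f F"
    and \<alpha>: "\<alpha> \<in> borel_measurable lebesgue" "\<And>\<omega>. \<bar>\<alpha> \<omega>\<bar> \<le> B"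
    and u: "\<And>\<omega>. complex_of_real (s \<omega>) * u \<omega> = f \<omega>"
    and V: "fourier_represents (\<lambda>\<omega>. u \<omega> + d \<omega>) V"
    and int: "integrable lebesgue (\<lambda>\<omega>. complex_of_real (s \<omega>) * d \<omega>)"
  shows "fourier_represents (\<lambda>\<omega>. u \<omega> + complex_of_real (1 - \<alpha> \<omega> * s \<omega>) * d \<omega>)
    (\<lambda>y. V y - mult_op \<alpha> (L_op T \<mu> V) y + mult_op \<alpha> F y)"
proof -
  have f: "integrable lebesgue f" using F by (simp add: fourier_represents_def)
  have \<alpha>_int: "integrable lebesgue (\<lambda>\<omega>. complex_of_real (\<alpha> \<omega>) * h \<omega>)"
    if "integrable lebesgue h" for h :: "real ^ 'n \<Rightarrow> complex"
    using \<alpha> by (intro integrable_bounded_mult[OF that]) auto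
  \<comment> \<open>The product equals \<open>f\<close> plus the symbol times \<open>d\<close>, both
    integrable.\<close>
  have s_int: "integrable lebesgue (\<lambda>\<omega>. complex_of_real (s \<omega>) * (u \<omega> + d \<omega>))"
    using f int by (simp add: distrib_left u)
  note L = fourier_represents_mult_op[OF V L_symbol_measurable s_int[unfolded s_def]]
  note \<alpha>L = fourier_represents_mult_op[OF L \<alpha>(1) \<alpha>_int[OF s_int[unfolded s_def]]]
  note \<alpha>F = fourier_represents_mult_op[OF F \<alpha>(1) \<alpha>_int[OF f]]
  \<comment> \<open>Replacing \<open>f\<close> by the symbol times \<open>u\<close> shows that
    \<open>u\<close> is a fixed point of the step and only the error is damped.\<close>
  have "u \<omega> + d \<omega> - complex_of_real (\<alpha> \<omega>) * (complex_of_real (s \<omega>) * (u \<omega> + d \<omega>))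
      + complex_of_real (\<alpha> \<omega>) * f \<omega> = u \<omega> + complex_of_real (1 - \<alpha> \<omega> * s \<omega>) * d \<omega>" for \<omega>
    unfolding u[symmetric] by (simp add: algebra_simps)
  with fourier_represents_add[OF fourier_represents_diff[OF V \<alpha>L] \<alpha>F]
  show ?thesis unfolding L_op_def s_def by (simp only:)
qed

text \<open>The supremum of \<open>\<bar>r x\<bar>\<close> may be 1, so no uniform geometric rate is
  available; the powers tend to 0 pointwise, and \<open>cmod (e x)\<close> dominates.\<close>

lemma integral_norm_power_tendsto_0:
  fixes e :: "'a \<Rightarrow> complex" and r :: "'a \<Rightarrow> real"
  assumes e: "integrable M e" and r: "r \<in> borel_measurable M" "\<And>x. \<bar>r x\<bar> < 1"
  shows "(\<lambda>j. LINT x|M. cmod (complex_of_real (r x ^ j) * e x)) \<longlonglongrightarrow> 0"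
proof -
  have "(\<lambda>j. LINT x|M. cmod (complex_of_real (r x ^ j) * e x)) \<longlonglongrightarrow> (LINT x|M. 0)"
  proof (rule integral_dominated_convergence[where w = "\<lambda>x. cmod (e x)"])
    have [measurable]: "e \<in> borel_measurable M" using e by simp
    note r(1) [measurable]
    show "(\<lambda>x. cmod (complex_of_real (r x ^ j) * e x)) \<in> borel_measurable M" for j by measurable
    show "AE x in M. (\<lambda>j. cmod (complex_of_real (r x ^ j) * e x)) \<longlonglongrightarrow> 0"
    proof (intro always_eventually allI)
      fix x
      have "(\<lambda>j. cmod (complex_of_real (r x ^ j) * e x)) \<longlonglongrightarrow> cmod (complex_of_real 0 * e x)"
        by (intro tendsto_intros LIMSEQ_power_zero) (use r(2) in simp)
      then show "(\<lambda>j. cmod (complex_of_real (r x ^ j) * e x)) \<longlonglongrightarrow> 0" by simp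
    qed
    show "AE x in M. norm (cmod (complex_of_real (r x ^ j) * e x)) \<le> cmod (e x)" for j
    proof (intro always_eventually allI)
      fix x
      have "\<bar>r x\<bar> ^ j \<le> 1" using r(2)[of x] by (intro power_le_one) auto
      then have "\<bar>r x\<bar> ^ j * cmod (e x) \<le> 1 * cmod (e x)" by (intro mult_right_mono) auto
      then show "norm (cmod (complex_of_real (r x ^ j) * e x)) \<le> cmod (e x)"
        by (simp add: norm_mult norm_power)
    qed
  qed (use e in simp_all)
  then show ?thesis by simp
qed

theorem theorem4p1:
  fixes T :: "real ^ 'm ^ 'n"
    and \<mu> :: real
    and F :: "real ^ 'n \<Rightarrow> complex"
    and \<alpha> :: "real ^ 'n \<Rightarrow> real"
    and U :: "nat \<Rightarrow> real ^ 'n \<Rightarrow> complex"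
    and Usol :: "real ^ 'n \<Rightarrow> complex"
    and k\<^sub>0 :: nat
  assumes "CARD('m) < CARD('n)"
    and "rank T = CARD('m)"
    and "\<mu> > 0"
    and "F \<in> W0"
    and "\<alpha> \<in> borel_measurable lebesgue"
    and "bounded (range \<alpha>)"
    and "\<And>\<omega>. \<bar>1 - \<alpha> \<omega> * (\<mu> + (norm (transpose T *v \<omega>))\<^sup>2)\<bar> < 1"
    and start: "(k\<^sub>0 = 0 \<and> U 0 = (\<lambda>y. 0)) \<or> (k\<^sub>0 = 1 \<and> U 1 = mult_op \<alpha> F)"
    and step: "\<And>k. k \<ge> k\<^sub>0 \<Longrightarrow>
      U (Suc k) = (\<lambda>y. U k y - mult_op \<alpha> (L_op T \<mu> (U k)) y + mult_op \<alpha> F y)"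
    and limit: "Usol = mult_op (\<lambda>\<omega>. 1 / (\<mu> + (norm (transpose T *v \<omega>))\<^sup>2)) F"
  shows "(\<forall>k\<ge>k\<^sub>0. U k \<in> L_domain T \<mu>)
    \<and> ((\<forall>V\<in>W0. mult_op \<alpha> V \<in> W0) \<longrightarrow> (\<forall>k\<ge>k\<^sub>0. U k \<in> W0))
    \<and> Usol \<in> W0 \<inter> L_domain T \<mu>
    \<and> L_op T \<mu> Usol = F
    \<and> (\<forall>V\<in>L_domain T \<mu>. L_op T \<mu> V = F \<longrightarrow> V = Usol)
    \<and> (\<lambda>k. W0_norm (\<lambda>y. U k y - Usol y)) \<longlonglongrightarrow> 0"
proof -
  define s where "s = L_symbol T \<mu>"
  define f where "f = fourier_transform F"
  define u where "u \<omega> = complex_of_real (1 / s \<omega>) * f \<omega>" for \<omega>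
  define r where "r \<omega> = 1 - \<alpha> \<omega> * s \<omega>" for \<omega>
  have s_eq: "\<mu> + (norm (transpose T *v \<omega>))\<^sup>2 = s \<omega>" for \<omega>
    by (simp add: s_def L_symbol_def)
  have s_ge: "\<mu> \<le> s \<omega>" for \<omega> by (simp add: s_def L_symbol_ge)
  have s_pos: "0 < s \<omega>" for \<omega> using s_ge[of \<omega>] \<open>\<mu> > 0\<close> by linarith
  have [measurable]: "s \<in> borel_measurable lebesgue" by (simp add: s_def)
  note assms(5) [measurable]
  have r_meas [measurable]: "r \<in> borel_measurable lebesgue" unfolding r_def[abs_def] by measurable
  have r_less: "\<bar>r \<omega>\<bar> < 1" for \<omega> using assms(7) unfolding r_def s_eq[symmetric] .
  obtain B where B: "\<And>\<omega>. \<bar>\<alpha> \<omega>\<bar> \<le> B"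
    using \<open>bounded (range \<alpha>)\<close> unfolding bounded_iff by (metis rangeI real_norm_def)
  have F: "fourier_represents f F" using W0D(1)[OF \<open>F \<in> W0\<close>] by (simp add: f_def)
  have f: "integrable lebesgue f" using F by (simp add: fourier_represents_def)
  have su: "complex_of_real (s \<omega>) * u \<omega> = f \<omega>" for \<omega>
    using s_pos[of \<omega>] by (simp add: u_def)
  have inv_meas: "(\<lambda>\<omega>. 1 / s \<omega>) \<in> borel_measurable lebesgue" by measurable
  have u: "integrable lebesgue u"
    unfolding u_def[abs_def]
  proof (rule integrable_bounded_mult[OF f])
    show "(\<lambda>\<omega>. complex_of_real (1 / s \<omega>)) \<in> borel_measurable lebesgue" by measurable
    show "cmod (complex_of_real (1 / s \<omega>)) \<le> 1 / \<mu>" for \<omega>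
      using s_ge[of \<omega>] s_pos[of \<omega>] \<open>\<mu> > 0\<close> by (simp only: norm_of_real) (simp add: frac_le)
  qed
  have Usol_eq: "Usol = mult_op (\<lambda>\<omega>. 1 / s \<omega>) F" using limit unfolding s_eq .
  have Usol: "fourier_represents u Usol"
    using fourier_represents_mult_op[OF F inv_meas] u by (simp add: Usol_eq u_def[abs_def])
  \<comment> \<open>The reciprocal of the symbol is even, so the solution is real-valued along with
    \<open>F\<close>.\<close>
  have Usol_W0: "Usol \<in> W0"
    unfolding Usol_eq
    using u by (intro mult_op_even_W0[OF \<open>F \<in> W0\<close> inv_meas])
      (simp_all add: s_def L_symbol_even u_def[abs_def] f_def)
  have Usol_dom: "Usol \<in> L_domain T \<mu>"
    using f by (simp add: L_domain_iff[OF Usol] su[unfolded s_def])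
  have "fourier_represents f (L_op T \<mu> Usol)"
    using fourier_represents_mult_op[OF Usol L_symbol_measurable[of T \<mu>]] f
    by (simp add: su[unfolded s_def] L_op_def)
  then have L_Usol: "L_op T \<mu> Usol = F" using F by (simp add: fourier_represents_def)
  have unique: "V = Usol" if V: "V \<in> L_domain T \<mu>" and LV: "L_op T \<mu> V = F" for V
  proof -
    let ?v = "fourier_transform V"
    have v: "fourier_represents ?v V" using V by (simp add: L_domain_def W0_complexD)
    have "fourier_represents (\<lambda>\<omega>. complex_of_real (s \<omega>) * ?v \<omega>) F"
      using fourier_represents_mult_op[OF v L_symbol_measurable[of T \<mu>]] V LV
      by (simp add: L_domain_def L_op_def s_def)
    then have "AE \<omega> in lebesgue. complex_of_real (s \<omega>) * ?v \<omega> = f \<omega>"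
      using F by (rule fourier_represents_unique)
    then have "AE \<omega> in lebesgue. ?v \<omega> = u \<omega>"
    proof eventually_elim
      case (elim \<omega>)
      then show ?case using s_pos[of \<omega>] by (simp add: u_def field_simps)
    qed
    then have "fourier_represents u V"
      using v u by (intro fourier_represents_AE_cong[OF v]) auto
    then show ?thesis using Usol by (simp add: fourier_represents_def)
  qed
  \<comment> \<open>Both starting values are treated at once: all that matters later is a
    representative whose product with the symbol is integrable.\<close>
  obtain g0 where g0: "fourier_represents g0 (U k\<^sub>0)"
    and sg0: "integrable lebesgue (\<lambda>\<omega>. complex_of_real (s \<omega>) * g0 \<omega>)"
  proof (cases "k\<^sub>0 = 0 \<and> U 0 = (\<lambda>y. 0)")
    case True
    then have "fourier_represents (\<lambda>\<omega>. 0) (U k\<^sub>0)" using fourier_represents_zero by simp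
    then show ?thesis by (rule that) simp
  next
    case False
    then have k: "k\<^sub>0 = 1" "U 1 = mult_op \<alpha> F" using start by auto
    have "integrable lebesgue (\<lambda>\<omega>. complex_of_real (\<alpha> \<omega>) * f \<omega>)"
      using B by (intro integrable_bounded_mult[OF f, where B = B]) auto
    then have "fourier_represents (\<lambda>\<omega>. complex_of_real (\<alpha> \<omega>) * f \<omega>) (U k\<^sub>0)"
      unfolding k by (rule fourier_represents_mult_op[OF F assms(5)])
    \<comment> \<open>The product of \<open>\<alpha>\<close> and the symbol is \<open>1 - r\<close>,
      bounded by 2 since \<open>\<bar>r \<omega>\<bar> < 1\<close>. Hence \<open>\<alpha> F\<close>
      lies in the domain of the operator.\<close>
    moreover have "integrable lebesgue (\<lambda>\<omega>. complex_of_real (1 - r \<omega>) * f \<omega>)"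
    proof (rule integrable_bounded_mult[OF f])
      show "cmod (complex_of_real (1 - r \<omega>)) \<le> 2" for \<omega>
        using r_less[of \<omega>] unfolding norm_of_real by linarith
    qed measurable
    then have "integrable lebesgue (\<lambda>\<omega>. complex_of_real (s \<omega>) * (complex_of_real (\<alpha> \<omega>) * f \<omega>))"
      by (simp add: r_def mult_ac)
    ultimately show ?thesis by (rule that)
  qed
  define d where "d \<omega> = g0 \<omega> - u \<omega>" for \<omega>
  have d: "integrable lebesgue d"
    using g0 u by (simp add: d_def[abs_def] fourier_represents_def)
  have sd: "integrable lebesgue (\<lambda>\<omega>. complex_of_real (s \<omega>) * d \<omega>)"
    using sg0 f by (simp add: d_def right_diff_distrib su)
  \<comment> \<open>Powers of \<open>r\<close> are bounded by 1, so every later error inherits the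
    integrability of the initial one; this keeps the iterates in the domain.\<close>
  have srd: "integrable lebesgue (\<lambda>\<omega>. complex_of_real (s \<omega>) * (complex_of_real (r \<omega> ^ j) * d \<omega>))" for j
  proof -
    have "cmod (complex_of_real (r \<omega> ^ j)) \<le> 1" for \<omega>
      using r_less[of \<omega>] unfolding norm_of_real power_abs by (intro power_le_one) auto
    then have "integrable lebesgue (\<lambda>\<omega>. complex_of_real (r \<omega> ^ j) * (complex_of_real (s \<omega>) * d \<omega>))"
      by (intro integrable_bounded_mult[OF sd]) measurable
    then show ?thesis by (simp add: mult_ac)
  qed
  \<comment> \<open>Closed form of the iterates, with \<open>j\<close> counting the steps after
    \<open>k\<^sub>0\<close>.\<close>
  have rep: "fourier_represents (\<lambda>\<omega>. u \<omega> + complex_of_real (r \<omega> ^ j) * d \<omega>) (U (k\<^sub>0 + j))" for j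
  proof (induction j)
    case 0
    show ?case using g0 by (simp add: d_def)
  next
    case (Suc j)
    have "U (k\<^sub>0 + Suc j) = (\<lambda>y. U (k\<^sub>0 + j) y - mult_op \<alpha> (L_op T \<mu> (U (k\<^sub>0 + j))) y + mult_op \<alpha> F y)"
      using step[of "k\<^sub>0 + j"] by simp
    then show ?case
      using fourier_represents_step[OF F assms(5) B su[unfolded s_def] Suc srd[unfolded s_def]]
      by (simp add: r_def s_def mult.assoc)
  qed
  have dom: "U k \<in> L_domain T \<mu>" if "k \<ge> k\<^sub>0" for k
  proof -
    have "integrable lebesgue (\<lambda>\<omega>. complex_of_real (s \<omega>) * (u \<omega> + complex_of_real (r \<omega> ^ j) * d \<omega>))" for j
      unfolding distrib_left su using f srd[of j] by (rule Bochner_Integration.integrable_add)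
    from this[of "k - k\<^sub>0"] show ?thesis
      using L_domain_iff[OF rep[of "k - k\<^sub>0"], of T \<mu>] that by (simp add: s_def)
  qed
  \<comment> \<open>The symbol of \<open>L_op\<close> is even and so preserves real-valuedness; for
    \<open>\<alpha>\<close>, which need not be even, this is the assumption.\<close>
  have real: "U k \<in> W0" if \<alpha>: "\<forall>V\<in>W0. mult_op \<alpha> V \<in> W0" and "k \<ge> k\<^sub>0" for k
    using \<open>k \<ge> k\<^sub>0\<close>
  proof (induction k rule: dec_induct)
    case base
    then show ?case
      using start \<alpha> \<open>F \<in> W0\<close> W0_complexI[OF fourier_represents_zero] by (auto simp: W0_def)
  next
    case (step k)
    have "L_op T \<mu> (U k) \<in> W0"
      unfolding L_op_def using dom[OF step.hyps(1)]
      by (intro mult_op_even_W0[OF step.IH] L_symbol_measurable L_symbol_even) (simp add: L_domain_def)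
    then show ?case
      unfolding assms(9)[OF step.hyps(1)] using \<alpha> step.IH \<open>F \<in> W0\<close> by (intro W0_add W0_diff) auto
  qed
  \<comment> \<open>The term \<open>u\<close> cancels, leaving the damped initial error.\<close>
  have "W0_norm (\<lambda>y. U (k\<^sub>0 + j) y - Usol y)
      = (1 / sqrt (2 * pi)) ^ CARD('n) * (LINT \<omega>|lebesgue. cmod (complex_of_real (r \<omega> ^ j) * d \<omega>))" for j
    using W0_norm_represents[OF fourier_represents_diff[OF rep[of j] Usol]] by simp
  moreover have "(\<lambda>j. (1 / sqrt (2 * pi)) ^ CARD('n) *
      (LINT \<omega>|lebesgue. cmod (complex_of_real (r \<omega> ^ j) * d \<omega>))) \<longlonglongrightarrow> 0"
    by (intro tendsto_mult_right_zero integral_norm_power_tendsto_0 d r_meas r_less)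
  ultimately have "(\<lambda>j. W0_norm (\<lambda>y. U (j + k\<^sub>0) y - Usol y)) \<longlonglongrightarrow> 0"
    by (simp add: add.commute)
  then have "(\<lambda>k. W0_norm (\<lambda>y. U k y - Usol y)) \<longlonglongrightarrow> 0"
    by (rule LIMSEQ_offset)
  with dom real Usol_W0 Usol_dom L_Usol unique show ?thesis by blast
qed

end
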